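(* Let $F$ be a field of characteristic $0$, let $\lambda,m,r,\eta,\tau\in F$, and let $(H_n)_{n\ge 0}$ be the sequence with $H_0=1$, $H_1=\lambda$, $H_2=m$, $H_3=r$, $H_4=\eta$ and $$H_{n+4}H_n=H_{n+3}H_{n+1}+\tau H_{n+2}^2\qquad(n\ge 1).$$ Assume that the data are nondegenerate, i.e. $H_n\neq 0$ for all $n\ge 1$ (so that the recurrence determines the sequence). This includes the generic case in which $\lambda,m,r,\eta,\tau$ are independent indeterminates and $F=\mathbb{Q}(\lambda,m,r,\eta,\tau)$. Let $A(z),B(z),C(z)\in F[z]$ be the explicit polynomials given in the context. Then there is exactly one formal power series $G(z)=\sum_{n\ge 0}g_nz^n\in F[[z]]$ with $$A(z)G(z)^2+B(z)G(z)+C(z)=0,\qquad g_0=\lambda,\qquad g_1=r,$$ and this series satisfies, for every $n\ge 1$, $$\det(g_{i+j})_{0\le i,j\le n-1}=H_n,\qquad \det(g_{i+j+1})_{0\le i,j\le n-1}=H_{n+2}.$$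
   Context: The polynomials are $$\begin{aligned} A(z)={}&\lambda\eta m r^2(\tau-\eta)z^3\\ &+r\Bigl(-(\lambda^2\eta m+m^2(m+r^2))\tau+(2m-1)\lambda^2\eta^2+\eta m^2(m+r^2)-\lambda r(m+r^2)\Bigr)z^2\\ &+\lambda\Bigl(m^2r^2\tau-(m-1)\lambda^2\eta^2-m(m^2+2mr^2-m-r^2)\eta+\lambda r^3\Bigr)z\\ &+\lambda^2\eta m(m-1)r, \end{aligned}$$ $$\begin{aligned} B(z)={}&-\lambda^2\eta m r^2\tau z^3\\ &+r\Bigl((2\lambda^3\eta m+\lambda m^2(2m+r^2))\tau-(2m-1)\lambda^3\eta^2-\lambda\eta m^3+\lambda^2r(2m+r^2)\Bigr)z^2\\ &+\lambda^2\Bigl(-2m^2r^2\tau+2(m-1)\lambda^2\eta^2+m(2m^2+2mr^2-2m-r^2)\eta-2\lambda r^3\Bigr)z\\ &-2\lambda^3\eta m(m-1)r, \end{aligned}$$ $$\begin{aligned} C(z)={}&-\lambda^2mr\Bigl(\tau(\lambda^2\eta+m^2)+\lambda r\Bigr)z^2\\ &+\Bigl(\lambda^3m^2r^2\tau+\lambda^4r^3-\lambda^3\eta(m-1)(\lambda^2\eta+m^2)\Bigr)z\\ &+\lambda^4\eta m(m-1)r. \end{aligned}$$ *)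

theory Defs
  imports
    "HOL-Computational_Algebra.Polynomial_FPS"
    "HOL-Computational_Algebra.Polynomial_Factorial"
    "Jordan_Normal_Form.Determinant"
begin

text \<open>The recurrence is imposed for \<open>n \<ge> 1\<close> only, so \<open>H 4 = \<eta>\<close> is a free initial value.\<close>

definition somos4_seq :: "'a::field \<Rightarrow> 'a \<Rightarrow> 'a \<Rightarrow> 'a \<Rightarrow> 'a \<Rightarrow> (nat \<Rightarrow> 'a) \<Rightarrow> bool" where
  "somos4_seq l m r \<eta> \<tau> H \<longleftrightarrow>
     H 0 = 1 \<and> H 1 = l \<and> H 2 = m \<and> H 3 = r \<and> H 4 = \<eta> \<and>
     (\<forall>n\<ge>1. H (n + 4) * H n = H (n + 3) * H (n + 1) + \<tau> * H (n + 2) ^ 2)"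

text \<open>In the three coefficient lists below the constant coefficient comes first.\<close>

definition polyA :: "'a::field \<Rightarrow> 'a \<Rightarrow> 'a \<Rightarrow> 'a \<Rightarrow> 'a \<Rightarrow> 'a poly" where
  "polyA l m r \<eta> \<tau> =
    [: l^2 * \<eta> * m * (m - 1) * r,
       l * (m^2 * r^2 * \<tau> - (m - 1) * l^2 * \<eta>^2
            - m * (m^2 + 2 * m * r^2 - m - r^2) * \<eta> + l * r^3),
       r * (- (l^2 * \<eta> * m + m^2 * (m + r^2)) * \<tau> + (2 * m - 1) * l^2 * \<eta>^2
            + \<eta> * m^2 * (m + r^2) - l * r * (m + r^2)),
       l * \<eta> * m * r^2 * (\<tau> - \<eta>) :]"

definition polyB :: "'a::field \<Rightarrow> 'a \<Rightarrow> 'a \<Rightarrow> 'a \<Rightarrow> 'a \<Rightarrow> 'a poly" where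
  "polyB l m r \<eta> \<tau> =
    [: - 2 * l^3 * \<eta> * m * (m - 1) * r,
       l^2 * (- 2 * m^2 * r^2 * \<tau> + 2 * (m - 1) * l^2 * \<eta>^2
              + m * (2 * m^2 + 2 * m * r^2 - 2 * m - r^2) * \<eta> - 2 * l * r^3),
       r * ((2 * l^3 * \<eta> * m + l * m^2 * (2 * m + r^2)) * \<tau> - (2 * m - 1) * l^3 * \<eta>^2
            - l * \<eta> * m^3 + l^2 * r * (2 * m + r^2)),
       - (l^2 * \<eta> * m * r^2 * \<tau>) :]"

definition polyC :: "'a::field \<Rightarrow> 'a \<Rightarrow> 'a \<Rightarrow> 'a \<Rightarrow> 'a \<Rightarrow> 'a poly" where
  "polyC l m r \<eta> \<tau> =
    [: l^4 * \<eta> * m * (m - 1) * r,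
       l^3 * m^2 * r^2 * \<tau> + l^4 * r^3 - l^3 * \<eta> * (m - 1) * (l^2 * \<eta> + m^2),
       - (l^2 * m * r * (\<tau> * (l^2 * \<eta> + m^2) + l * r)) :]"

definition is_branch :: "'a::field \<Rightarrow> 'a \<Rightarrow> 'a \<Rightarrow> 'a \<Rightarrow> 'a \<Rightarrow> 'a fps \<Rightarrow> bool" where
  "is_branch l m r \<eta> \<tau> G \<longleftrightarrow>
     fps_of_poly (polyA l m r \<eta> \<tau>) * G ^ 2 + fps_of_poly (polyB l m r \<eta> \<tau>) * G
       + fps_of_poly (polyC l m r \<eta> \<tau>) = 0
     \<and> fps_nth G 0 = l \<and> fps_nth G 1 = r"

text \<open>The rational function field over the rationals in five independent indeterminates,
  as the fraction field of an iterated polynomial ring; \<open>gen_l\<close> is the outermost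
  variable and \<open>gen_tau\<close> the innermost. It is of characteristic 0, being a
  \<open>linordered_field\<close> in the library.\<close>

type_synonym ratfun5 = "rat poly poly poly poly poly fract"

definition gen_l :: ratfun5 where "gen_l = to_fract [:0, 1:]"
definition gen_m :: ratfun5 where "gen_m = to_fract [:[:0, 1:]:]"
definition gen_r :: ratfun5 where "gen_r = to_fract [:[:[:0, 1:]:]:]"
definition gen_eta :: ratfun5 where "gen_eta = to_fract [:[:[:[:0, 1:]:]:]:]"
definition gen_tau :: ratfun5 where "gen_tau = to_fract [:[:[:[:[:0, 1:]:]:]:]:]"

end

theory Submission
  imports Defs
begin

text \<open>
  The branch \<open>G\<close> has a Stieltjes continued fraction
  \<open>G = l / (1 - q\<^sub>1 z / (1 - q\<^sub>2 z / (1 - \<dots>)))\<close>, and Hankel determinants can be read off such a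
  fraction: peeling one level off swaps the Hankel matrix with the shifted one, up to powers of
  the coefficient (\<open>hankel_det_stieltjes\<close>). What has to be seen is that the coefficients \<open>q\<^sub>i\<close> are the
  right quotients of the \<open>H n\<close>.

  After the first two levels, every second tail \<open>T\<close> of the fraction satisfies a quadratic equation
  of one fixed shape, \<open>somos_tail\<close>, whose parameters \<open>a\<close> and \<open>b\<close> are the next and the previous
  coefficient of the fraction (for the first such tail \<open>b\<close> is \<open>m\<close> times the previous
  coefficient). Peeling off two levels reproduces the shape with
  \<open>b' = 1 / (a b)\<close> and \<open>a' = b + \<tau> / a\<close> (\<open>somos_tail_step\<close>). For
  \<open>a = H (j + 3) * H j / (H (j + 1) * H (j + 2))\<close> and \<open>b = H (j + 1)\<^sup>2 / (H j * H (j + 2))\<close>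
  the first rule is an identity and the second is exactly the recurrence, so one step moves \<open>j\<close> to
  \<open>j + 1\<close>. Induction on the size of the matrix then gives both determinants of a tail
  (\<open>hankel_det_somos_tail\<close>).

  The polynomials \<open>A\<close>, \<open>B\<close>, \<open>C\<close> are what results when \<open>G\<close>, a Moebius transform of the tail \<open>T\<close> for
  \<open>j = 1\<close>, is substituted for \<open>T\<close> in its quadratic equation (\<open>is_branch_iff_somos_tail\<close>). In the
  equation of a tail the linear coefficient has constant term \<open>-1\<close> and the quadratic coefficient
  has none, so exactly one power series solves it; existence and uniqueness of \<open>G\<close> follow.

  That nondegenerate data include the indeterminates is a matter of signs: the rational function
  field can be ordered so that all five indeterminates are positive, and the recurrence preserves
  positivity.
\<close>

no_notation vec_index (infixl \<open>$\<close> 100)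
unbundle fps_syntax

section \<open>Hankel determinants and continued fractions\<close>

definition hankel_det :: "'a::comm_ring_1 fps \<Rightarrow> nat \<Rightarrow> 'a" where
  "hankel_det F n = det (mat n n (\<lambda>(i, j). fps_nth F (i + j)))"

lemma hankel_det_0 [simp]: "hankel_det F 0 = 1"
  by (simp add: hankel_det_def)

lemma hankel_det_const_mult:
  "hankel_det (fps_const q * F) n = q ^ n * hankel_det F n"
proof -
  have "mat n n (\<lambda>(i, j). fps_nth (fps_const q * F) (i + j)) =
        q \<cdot>\<^sub>m mat n n (\<lambda>(i, j). fps_nth F (i + j))"
    by (rule eq_matI) auto
  then show ?thesis by (simp add: hankel_det_def)
qed

lemma det_toeplitz_lower:
  "det (mat n n (\<lambda>(i, j). if j \<le> i then fps_nth F (i - j) else 0)) = fps_nth F 0 ^ n"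
  by (subst det_lower_triangular[of n]) (auto simp: prod_list_diag_prod)

lemma det_toeplitz_upper:
  "det (mat n n (\<lambda>(i, j). if i \<le> j then fps_nth F (j - i) else 0)) = fps_nth F 0 ^ n"
  by (subst det_upper_triangular[of _ n]) (auto simp: prod_list_diag_prod)

text \<open>
  Entry \<open>(i, l)\<close> of a lower triangular Toeplitz matrix times a Hankel matrix is an incomplete
  convolution; the missing terms are moved to the other side because \<open>P * G\<close> will be constant.
\<close>

lemma fps_mult_nth_split:
  fixes P G :: "'a::comm_ring_1 fps"
  shows "(\<Sum>k\<le>i. P $ (i - k) * G $ (k + l)) =
         (P * G) $ (i + l) - (\<Sum>k<l. P $ (i + l - k) * G $ k)"
proof -
  have "(P * G) $ (i + l) = (\<Sum>k\<le>i + l. P $ (i + l - k) * G $ k)"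
    by (subst mult.commute) (simp only: fps_mult_nth atLeast0AtMost mult.commute)
  also have "{..i + l} = {..<l} \<union> {l..i + l}" by auto
  also have "(\<Sum>k\<in>{..<l} \<union> {l..i + l}. P $ (i + l - k) * G $ k) =
      (\<Sum>k<l. P $ (i + l - k) * G $ k) + (\<Sum>k=l..i + l. P $ (i + l - k) * G $ k)"
    by (rule sum.union_disjoint) auto
  also have "(\<Sum>k=l..i + l. P $ (i + l - k) * G $ k) =
             (\<Sum>k\<le>i. P $ (i - k) * G $ (k + l))"
    by (rule sum.reindex_bij_witness[of _ "\<lambda>k. k + l" "\<lambda>k. k - l"]) auto
  finally show ?thesis by simp
qed

text \<open>
  With \<open>P = 1 - x W(x)\<close> and \<open>P G = c\<close>, multiplying the generating function
  \<open>(G(x) - G(y)) / (x - y)\<close> of the shifted Hankel matrix by \<open>P(x)\<close> gives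
  \<open>(x W(x) - y W(y)) / (x - y) * G(y)\<close>. So Toeplitz(\<open>P\<close>) times the shifted Hankel matrix of \<open>G\<close>
  is the Hankel matrix of \<open>W\<close> times a transposed Toeplitz(\<open>G\<close>), and the Toeplitz factors
  are triangular.
\<close>

lemma hankel_det_recip_shift:
  fixes G W :: "'a::idom fps"
  assumes "G * (1 - fps_X * W) = fps_const c"
  shows "hankel_det (fps_shift 1 G) n = c ^ n * hankel_det W n"
proof -
  define P where "P = 1 - fps_X * W"
  have PG: "P * G = fps_const c" using assms by (simp add: P_def mult.commute)
  have P0: "P $ 0 = 1" and PS: "P $ Suc k = - W $ k" for k by (simp_all add: P_def)
  have G0: "G $ 0 = c" using arg_cong[OF PG, of "\<lambda>F. F $ 0"] P0 by simp
  let ?L = "mat n n (\<lambda>(i, j). if j \<le> i then P $ (i - j) else 0)"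
  let ?U = "mat n n (\<lambda>(i, j). if i \<le> j then G $ (j - i) else 0)"
  let ?H = "mat n n (\<lambda>(i, j). fps_shift 1 G $ (i + j))"
  let ?M = "mat n n (\<lambda>(i, j). W $ (i + j))"
  have "?L * ?H = ?M * ?U"
  proof (rule eq_matI)
    fix i l assume il: "i < dim_row (?M * ?U)" "l < dim_col (?M * ?U)"
    then have i: "i < n" and l: "l < n" by auto
    have "(?L * ?H) $$ (i, l) =
        (\<Sum>k = 0..<n. (if k \<le> i then P $ (i - k) else 0) * G $ (k + Suc l))"
      using i l by (simp add: scalar_prod_def)
    also have "\<dots> = (\<Sum>k\<le>i. P $ (i - k) * G $ (k + Suc l))"
      by (rule sum.mono_neutral_cong_right) (use i in auto)
    also have "\<dots> = - (\<Sum>k<Suc l. P $ (i + Suc l - k) * G $ k)"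
      by (subst fps_mult_nth_split) (simp add: PG del: sum.lessThan_Suc)
    also have "\<dots> = (\<Sum>k<Suc l. W $ (i + (l - k)) * G $ k)"
      unfolding sum_negf[symmetric]
    proof (rule sum.cong[OF refl])
      fix k assume "k \<in> {..<Suc l}"
      then have "i + Suc l - k = Suc (i + (l - k))" by auto
      then show "- (P $ (i + Suc l - k) * G $ k) = W $ (i + (l - k)) * G $ k"
        by (simp only: PS) simp
    qed
    also have "\<dots> = (\<Sum>k\<le>l. W $ (i + k) * G $ (l - k))"
      by (rule sum.reindex_bij_witness[of _ "\<lambda>k. l - k" "\<lambda>k. l - k"]) auto
    also have "\<dots> = (\<Sum>k = 0..<n. W $ (i + k) * (if k \<le> l then G $ (l - k) else 0))"
      by (rule sum.mono_neutral_cong_left) (use l in auto)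
    also have "\<dots> = (?M * ?U) $$ (i, l)"
      using i l by (simp add: scalar_prod_def)
    finally show "(?L * ?H) $$ (i, l) = (?M * ?U) $$ (i, l)" .
  qed auto
  then have "det ?L * det ?H = det ?M * det ?U"
    by (simp only: det_mult[OF mat_carrier mat_carrier, symmetric])
  then show ?thesis
    by (simp add: det_toeplitz_lower det_toeplitz_upper P0 G0 hankel_det_def mult.commute
        del: fps_shift_nth)
qed

text \<open>
  The same factorization for the unshifted matrix, with generating function
  \<open>(x G(x) - y G(y)) / (x - y)\<close>: the factor \<open>P(x)\<close> now leaves
  \<open>(1 + x y (W(x) - W(y)) / (x - y)) * G(y)\<close>, that is, the shifted Hankel matrix of \<open>W\<close> bordered by
  a row and a column of the identity matrix.
\<close>

lemma hankel_det_recip: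
  fixes G W :: "'a::idom fps"
  assumes "G * (1 - fps_X * W) = fps_const c"
  shows "hankel_det G (Suc n) = c ^ Suc n * hankel_det (fps_shift 1 W) n"
proof -
  define P where "P = 1 - fps_X * W"
  have PG: "P * G = fps_const c" using assms by (simp add: P_def mult.commute)
  have P0: "P $ 0 = 1" and PS: "P $ Suc k = - W $ k" for k by (simp_all add: P_def)
  have G0: "G $ 0 = c" using arg_cong[OF PG, of "\<lambda>F. F $ 0"] P0 by simp
  let ?N = "Suc n"
  let ?L = "mat ?N ?N (\<lambda>(i, j). if j \<le> i then P $ (i - j) else 0)"
  let ?U = "mat ?N ?N (\<lambda>(i, j). if i \<le> j then G $ (j - i) else 0)"
  let ?H = "mat ?N ?N (\<lambda>(i, j). G $ (i + j))"
  define m where "m i j = (if i = 0 \<or> j = 0 then if i = j then 1 else 0 else W $ (i + j - 1))" for i j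
  let ?M = "mat ?N ?N (\<lambda>(i, j). m i j)"
  let ?S = "mat n n (\<lambda>(i, j). fps_shift 1 W $ (i + j))"
  have "?L * ?H = ?M * ?U"
  proof (rule eq_matI)
    fix i l assume il: "i < dim_row (?M * ?U)" "l < dim_col (?M * ?U)"
    then have i: "i < ?N" and l: "l < ?N" by auto
    have "(?L * ?H) $$ (i, l) =
        (\<Sum>k = 0..<?N. (if k \<le> i then P $ (i - k) else 0) * G $ (k + l))"
      using i l by (simp add: scalar_prod_def del: sum.op_ivl_Suc)
    also have "\<dots> = (\<Sum>k\<le>i. P $ (i - k) * G $ (k + l))"
      by (rule sum.mono_neutral_cong_right) (use i in auto)
    also have "\<dots> = (\<Sum>k\<le>l. m i k * G $ (l - k))"
    proof (cases "i = 0")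
      case True
      have "(\<Sum>k\<le>l. m 0 k * G $ (l - k)) = (\<Sum>k\<in>{0}. m 0 k * G $ (l - k))"
        by (rule sum.mono_neutral_right) (auto simp: m_def)
      then show ?thesis using True P0 by (simp add: m_def)
    next
      case False
      have "(\<Sum>k\<le>i. P $ (i - k) * G $ (k + l)) = - (\<Sum>k<l. P $ (i + l - k) * G $ k)"
        using False by (simp add: fps_mult_nth_split PG)
      also have "\<dots> = (\<Sum>k<l. m i (l - k) * G $ k)"
        unfolding sum_negf[symmetric]
      proof (rule sum.cong[OF refl])
        fix k assume "k \<in> {..<l}"
        then have "i + l - k = Suc (i + (l - k) - 1)" "l - k \<noteq> 0" by auto
        then show "- (P $ (i + l - k) * G $ k) = m i (l - k) * G $ k"
          using False by (simp only: PS m_def) simp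
      qed
      also have "\<dots> = (\<Sum>k\<in>{1..l}. m i k * G $ (l - k))"
        by (rule sum.reindex_bij_witness[of _ "\<lambda>k. l - k" "\<lambda>k. l - k"]) auto
      also have "\<dots> = (\<Sum>k\<le>l. m i k * G $ (l - k))"
        by (rule sum.mono_neutral_left) (use False in \<open>auto simp: m_def\<close>)
      finally show ?thesis .
    qed
    also have "\<dots> = (\<Sum>k = 0..<?N. m i k * (if k \<le> l then G $ (l - k) else 0))"
      by (rule sum.mono_neutral_cong_left) (use l in auto)
    also have "\<dots> = (?M * ?U) $$ (i, l)"
      using i l by (simp add: scalar_prod_def del: sum.op_ivl_Suc)
    finally show "(?L * ?H) $$ (i, l) = (?M * ?U) $$ (i, l)" .
  qed auto
  then have "det ?L * det ?H = det ?M * det ?U"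
    by (simp only: det_mult[OF mat_carrier mat_carrier, symmetric])
  moreover have "det ?M = det ?S"
  proof -
    have "?M = four_block_mat (1\<^sub>m 1) (0\<^sub>m 1 n) (0\<^sub>m n 1) ?S"
      by (rule eq_matI) (auto simp: m_def)
    also have "det \<dots> = det (1\<^sub>m 1 :: 'a mat) * det ?S"
      by (rule det_four_block_mat_lower_left_zero_col) auto
    finally show ?thesis by (simp del: fps_shift_nth)
  qed
  ultimately show ?thesis
    by (simp add: det_toeplitz_lower det_toeplitz_upper P0 G0 hankel_det_def mult_ac
        del: fps_shift_nth)
qed

lemma hankel_det_stieltjes:
  fixes G W :: "'a::idom fps"
  assumes "G * (1 - fps_const q * fps_X * W) = fps_const c"
  shows "hankel_det (fps_shift 1 G) n = (c * q) ^ n * hankel_det W n"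
    and "hankel_det G (Suc n) = c ^ Suc n * q ^ n * hankel_det (fps_shift 1 W) n"
proof -
  have *: "G * (1 - fps_X * (fps_const q * W)) = fps_const c"
    using assms by (simp add: mult_ac)
  have shift: "fps_shift 1 (fps_const q * W) = fps_const q * fps_shift 1 W"
    by (rule fps_ext) simp
  show "hankel_det (fps_shift 1 G) n = (c * q) ^ n * hankel_det W n"
    by (simp only: hankel_det_recip_shift[OF *] hankel_det_const_mult power_mult_distrib mult.assoc)
  show "hankel_det G (Suc n) = c ^ Suc n * q ^ n * hankel_det (fps_shift 1 W) n"
    by (simp only: hankel_det_recip[OF *] shift hankel_det_const_mult mult.assoc)
qed

text \<open>
  Conversely, a series with the right constant term can always be written with one level of the
  fraction split off; the second conclusion fixes the constant term of the remainder.
\<close>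

lemma fps_peel_stieltjes:
  fixes G :: "'a::field fps"
  assumes "c \<noteq> 0" "q \<noteq> 0" "G $ 0 = c"
  obtains W where "G * (1 - fps_const q * fps_X * W) = fps_const c" "G $ 1 = c * q * W $ 0"
proof -
  define V where "V = fps_shift 1 (1 - fps_const c * inverse G)"
  define W where "W = fps_const (1 / q) * V"
  have V: "fps_X * V = 1 - fps_const c * inverse G"
    unfolding V_def by (rule fps_ext) (use assms in \<open>simp add: fps_X_mult_nth field_simps\<close>)
  have "fps_const q * fps_X * W = (fps_const q * fps_const (1 / q)) * (fps_X * V)"
    unfolding W_def by (simp only: mult_ac)
  also have "fps_const q * fps_const (1 / q) = 1" using assms by simp
  also note V
  finally have "G * (1 - fps_const q * fps_X * W) = fps_const c * (inverse G * G)"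
    by (simp only: mult_ac) simp
  then have 2: "G * (1 - fps_const q * fps_X * W) = fps_const c"
    using assms by (simp add: inverse_mult_eq_1)
  have "G $ 1 = c * q * W $ 0"
    using arg_cong[OF 2, of "\<lambda>F. F $ 1"] assms by (simp add: fps_mult_nth mult_ac)
  with 2 that show thesis by blast
qed

section \<open>The quadratic equation of a tail\<close>

text \<open>
  The quadratic formula in the form \<open>W = - 2 R / (Q + sqrt (Q\<^sup>2 - 4 P R))\<close>, which avoids dividing
  by the non-unit \<open>P\<close>. Only one power series can be a root, because two of them would sum to \<open>- Q / P\<close>, which has a pole.
\<close>

lemma fps_quadratic_ex1:
  fixes P Q R :: "'a::field_char_0 fps"
  assumes Q: "Q $ 0 \<noteq> 0" and P: "P $ 0 = 0"
  shows "\<exists>!W. P * W ^ 2 + Q * W + R = 0"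
proof (rule ex_ex1I)
  define D where "D = Q ^ 2 - 4 * P * R"
  define S where "S = fps_radical (\<lambda>k x. Q $ 0) 2 D"
  have D0: "D $ 0 = (Q $ 0) ^ 2" by (simp add: D_def power2_eq_square P)
  have S2: "S ^ 2 = D"
    using power_radical[of D "\<lambda>k x. Q $ 0" 1] assms D0 by (simp add: S_def numeral_2_eq_2)
  have S0: "S $ 0 = Q $ 0" by (simp add: S_def)
  have inv: "inverse (Q + S) * (Q + S) = 1"
    using assms S0 by (intro inverse_mult_eq_1) (simp flip: mult_2)
  define W where "W = - 2 * R * inverse (Q + S)"
  have "P * W ^ 2 + Q * W + R = P * W ^ 2
      + Q * W * (inverse (Q + S) * (Q + S)) + R * (inverse (Q + S) * (Q + S)) ^ 2"
    by (simp only: inv) simp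
  also have "\<dots> = inverse (Q + S) ^ 2 * R * (S ^ 2 - D)"
    unfolding W_def D_def by (simp add: algebra_simps power2_eq_square)
  also have "\<dots> = 0" by (simp add: S2)
  finally show "\<exists>W. P * W ^ 2 + Q * W + R = 0" by auto
next
  fix V W assume "P * V ^ 2 + Q * V + R = 0" "P * W ^ 2 + Q * W + R = 0"
  then have "(P * V ^ 2 + Q * V + R) - (P * W ^ 2 + Q * W + R) = 0" by simp
  also have "(P * V ^ 2 + Q * V + R) - (P * W ^ 2 + Q * W + R) =
      (V - W) * (P * (V + W) + Q)" by (simp add: algebra_simps power2_eq_square)
  finally have "(V - W) * (P * (V + W) + Q) = 0" .
  moreover have "(P * (V + W) + Q) $ 0 \<noteq> 0" using Q P by simp
  ultimately show "V = W" by (metis eq_iff_diff_eq_0 fps_zero_nth mult_eq_0_iff)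
qed

text \<open>
  The normal form shared by all tails of even depth. In the steps and at the start the parameters
  satisfy \<open>a e = \<tau> + 1 / b\<close>, and \<open>e\<close> is the value that \<open>a\<close> has one step earlier
  (at the start, the value it would have if the step were run backwards).
\<close>

definition somos_tail :: "'a::field \<Rightarrow> 'a \<Rightarrow> 'a \<Rightarrow> 'a \<Rightarrow> 'a fps \<Rightarrow> bool" where
  "somos_tail \<tau> a b e T \<longleftrightarrow>
     fps_const b * fps_X * (1 - fps_const a * fps_X) * T ^ 2
     - (1 - fps_const (a + e - b) * fps_X + fps_const \<tau> * fps_X ^ 2) * T
     + (1 - fps_const e * fps_X) = 0"

lemma somos_tail_ex1: "\<exists>!T. somos_tail \<tau> a b e (T :: 'a::field_char_0 fps)"
proof -
  have "somos_tail \<tau> a b e T \<longleftrightarrow>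
     (fps_const b * fps_X * (1 - fps_const a * fps_X)) * T ^ 2
     + (- (1 - fps_const (a + e - b) * fps_X + fps_const \<tau> * fps_X ^ 2)) * T
     + (1 - fps_const e * fps_X) = 0" for T
    unfolding somos_tail_def by (simp only: mult_minus_left add_uminus_conv_diff)
  then show ?thesis
    by (simp only:) (rule fps_quadratic_ex1; simp add: power2_eq_square)
qed

lemma somos_tail_nth_0: "somos_tail \<tau> a b e T \<Longrightarrow> T $ 0 = 1"
  unfolding somos_tail_def
  by (drule arg_cong[of _ _ "\<lambda>F. F $ 0"]) (simp add: power2_eq_square)

text \<open>
  Substituting \<open>T = 1 / (1 - a z U)\<close> turns the equation of \<open>T\<close> into one for \<open>U\<close> from which a factor
  \<open>a z\<close> can be cancelled, since \<open>T $ 0 = 1\<close> is a root modulo \<open>z\<close>. The new constant coefficient is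
  \<open>1 - a' z\<close>, which is where \<open>a' = b + \<tau> / a\<close> comes from. Doing this again with \<open>U\<close> restores the
  original shape precisely when the next coefficient is \<open>1 / (a b)\<close>.
\<close>

lemma somos_tail_step:
  fixes T :: "'a::field fps"
  assumes tail: "somos_tail \<tau> a b e T" and inv: "b * (a * e - \<tau>) = 1" and "a \<noteq> 0"
  obtains U T' where
    "T * (1 - fps_const a * fps_X * U) = 1"
    "U * (1 - fps_const (1 / (a * b)) * fps_X * T') = 1"
    "somos_tail \<tau> (b + \<tau> / a) (1 / (a * b)) a T'"
proof -
  have "b \<noteq> 0" using inv by auto
  define \<alpha> \<beta> \<epsilon> \<theta> x :: "'a fps" where
    "\<alpha> = fps_const a" and "\<beta> = fps_const b" and "\<epsilon> = fps_const e" and "\<theta> = fps_const \<tau>"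
    and "x = fps_X"
  define a' b' where "a' = b + \<tau> / a" and "b' = 1 / (a * b)"
  define \<alpha>' \<beta>' where "\<alpha>' = fps_const a'" and "\<beta>' = fps_const b'"
  have "a * a' = a * b + \<tau>" "a * e = \<tau> + a * b'" "a - b' - a' = a - b - e"
    using \<open>a \<noteq> 0\<close> \<open>b \<noteq> 0\<close> inv by (auto simp: a'_def b'_def field_simps)
  then have rel: "\<alpha> * \<alpha>' = \<alpha> * \<beta> + \<theta>" "\<alpha> * \<epsilon> = \<theta> + \<alpha> * \<beta>'"
    "\<alpha> - \<beta>' - \<alpha>' = \<alpha> - \<beta> - \<epsilon>"
    using inv by (simp_all add: \<alpha>_def \<beta>_def \<epsilon>_def \<theta>_def \<alpha>'_def \<beta>'_def)
  have nz: "\<alpha> * x \<noteq> 0" "\<beta>' * x \<noteq> 0"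
    using \<open>a \<noteq> 0\<close> \<open>b \<noteq> 0\<close> by (auto simp: \<alpha>_def \<beta>'_def b'_def x_def)
  have T: "\<beta> * x * (1 - \<alpha> * x) * T ^ 2 - (1 - (\<alpha> + \<epsilon> - \<beta>) * x + \<theta> * x ^ 2) * T
     + (1 - \<epsilon> * x) = 0"
    using tail by (simp add: somos_tail_def \<alpha>_def \<beta>_def \<epsilon>_def \<theta>_def x_def)
  have "T $ 0 = 1" using tail by (rule somos_tail_nth_0)
  with \<open>a \<noteq> 0\<close> obtain U where "T * (1 - fps_const a * fps_X * U) = fps_const 1"
    by (rule fps_peel_stieltjes[rotated]) auto
  then have TU: "T * (1 - \<alpha> * x * U) = 1" by (simp add: \<alpha>_def x_def)
  \<comment> \<open>Multiplied by \<open>a z T\<^sup>2\<close>, the equation of \<open>U\<close> involves \<open>U\<close> only through \<open>a z U T = T - 1\<close>.\<close>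
  have "T ^ 2 * (\<alpha> * x) * (\<alpha> * x * (1 - \<epsilon> * x) * U ^ 2
      - (1 + (\<alpha> - \<beta> - \<epsilon>) * x - \<theta> * x ^ 2) * U + (1 - \<alpha>' * x)) =
      (1 - \<epsilon> * x) * (\<alpha> * x * U * T) ^ 2
      - (1 + (\<alpha> - \<beta> - \<epsilon>) * x - \<theta> * x ^ 2) * (\<alpha> * x * U * T) * T
      + (\<alpha> * x - \<alpha> * \<alpha>' * x ^ 2) * T ^ 2"
    by (simp add: algebra_simps power2_eq_square)
  also have "\<alpha> * x * U * T = T - 1" using TU by (simp add: algebra_simps)
  also have "\<alpha> * \<alpha>' = \<alpha> * \<beta> + \<theta>" by (rule rel)
  also have "(1 - \<epsilon> * x) * (T - 1) ^ 2
      - (1 + (\<alpha> - \<beta> - \<epsilon>) * x - \<theta> * x ^ 2) * (T - 1) * T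
      + (\<alpha> * x - (\<alpha> * \<beta> + \<theta>) * x ^ 2) * T ^ 2 =
      \<beta> * x * (1 - \<alpha> * x) * T ^ 2 - (1 - (\<alpha> + \<epsilon> - \<beta>) * x + \<theta> * x ^ 2) * T
      + (1 - \<epsilon> * x)"
    by (simp add: algebra_simps power2_eq_square)
  also note T
  finally have "T ^ 2 * (\<alpha> * x) * (\<alpha> * x * (1 - \<epsilon> * x) * U ^ 2
      - (1 + (\<alpha> - \<beta> - \<epsilon>) * x - \<theta> * x ^ 2) * U + (1 - \<alpha>' * x)) = 0" .
  then have U: "\<alpha> * x * (1 - \<epsilon> * x) * U ^ 2
      - (1 + (\<alpha> - \<beta> - \<epsilon>) * x - \<theta> * x ^ 2) * U + (1 - \<alpha>' * x) = 0"
    using nz \<open>T $ 0 = 1\<close> by auto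
  have "U $ 0 = 1"
    using arg_cong[OF U, of "\<lambda>F. F $ 0"] by (simp add: x_def power2_eq_square \<alpha>_def \<alpha>'_def)
  then obtain T' where "U * (1 - fps_const b' * fps_X * T') = fps_const 1"
    using nz(2) by (rule_tac fps_peel_stieltjes[of 1 b' U]) (auto simp: \<beta>'_def)
  then have UT: "U * (1 - \<beta>' * x * T') = 1" by (simp add: \<beta>'_def x_def)
  have "U ^ 2 * (\<beta>' * x) * (\<beta>' * x * (1 - \<alpha>' * x) * T' ^ 2
      - (1 - (\<alpha>' + \<alpha> - \<beta>') * x + \<theta> * x ^ 2) * T' + (1 - \<alpha> * x)) =
      (1 - \<alpha>' * x) * (\<beta>' * x * T' * U) ^ 2
      - (1 - (\<alpha>' + \<alpha> - \<beta>') * x + \<theta> * x ^ 2) * (\<beta>' * x * T' * U) * U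
      + \<beta>' * x * (1 - \<alpha> * x) * U ^ 2"
    by (simp add: algebra_simps power2_eq_square)
  also have "\<beta>' * x * T' * U = U - 1" using UT by (simp add: algebra_simps)
  also have "(1 - \<alpha>' * x) * (U - 1) ^ 2
      - (1 - (\<alpha>' + \<alpha> - \<beta>') * x + \<theta> * x ^ 2) * (U - 1) * U
      + \<beta>' * x * (1 - \<alpha> * x) * U ^ 2 =
      x * (\<alpha> - (\<theta> + \<alpha> * \<beta>') * x) * U ^ 2
      - (1 + (\<alpha> - \<beta>' - \<alpha>') * x - \<theta> * x ^ 2) * U + (1 - \<alpha>' * x)"
    by (simp add: algebra_simps power2_eq_square)
  also note rel(2)[symmetric]
  also note rel(3)
  also have "x * (\<alpha> - \<alpha> * \<epsilon> * x) * U ^ 2 = \<alpha> * x * (1 - \<epsilon> * x) * U ^ 2" by (simp add: algebra_simps power2_eq_square)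
  finally have "U ^ 2 * (\<beta>' * x) * (\<beta>' * x * (1 - \<alpha>' * x) * T' ^ 2
      - (1 - (\<alpha>' + \<alpha> - \<beta>') * x + \<theta> * x ^ 2) * T' + (1 - \<alpha> * x)) = 0" using U by simp
  then have "\<beta>' * x * (1 - \<alpha>' * x) * T' ^ 2
      - (1 - (\<alpha>' + \<alpha> - \<beta>') * x + \<theta> * x ^ 2) * T' + (1 - \<alpha> * x) = 0"
    using nz \<open>U $ 0 = 1\<close> by auto
  then have "somos_tail \<tau> a' b' a T'"
    by (simp add: somos_tail_def \<alpha>_def \<beta>'_def \<theta>_def \<alpha>'_def x_def)
  with TU UT show thesis
    unfolding a'_def b'_def \<alpha>_def \<beta>'_def x_def by (rule that)
qed

text \<open>
  Unrolled, the determinants are weighted products of the coefficients of the fraction. Since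
  \<open>a b = H j * H (j + 2) / H (j + 1)\<^sup>2\<close> is a multiplicative second difference of \<open>H\<close>, they telescope.
  The closed forms are also correct for \<open>n = 0\<close>, where the induction starts.
\<close>

lemma hankel_det_somos_tail:
  fixes H :: "nat \<Rightarrow> 'a::field"
  assumes rec: "\<And>n. n \<ge> 1 \<Longrightarrow> H (n + 4) * H n = H (n + 3) * H (n + 1) + \<tau> * H (n + 2) ^ 2"
    and nz: "\<And>n. n \<ge> 1 \<Longrightarrow> H n \<noteq> 0"
    and "j \<ge> 1"
    and "a = H (j + 3) * H j / (H (j + 1) * H (j + 2))"
    and "b = H (j + 1) ^ 2 / (H j * H (j + 2))"
    and "b * (a * e - \<tau>) = 1"
    and "somos_tail \<tau> a b e T"
  shows "hankel_det T n = H (j + n) * H j ^ n / (H j * H (j + 1) ^ n) \<and>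
         hankel_det (fps_shift 1 T) n = H (j + n + 2) * H j ^ n / (H (j + 2) * H (j + 1) ^ n)"
  using assms(3-)
proof (induction n arbitrary: j a b e T)
  case 0
  then show ?case using nz by simp
next
  case (Suc n)
  have nzj: "H j \<noteq> 0" "H (j + 1) \<noteq> 0" "H (j + 2) \<noteq> 0" "H (j + 3) \<noteq> 0" "H (j + 4) \<noteq> 0"
    using nz Suc.prems(1) by auto
  have "a \<noteq> 0" using nzj Suc.prems(2) by simp
  obtain U T' where
    TU: "T * (1 - fps_const a * fps_X * U) = 1" and
    UT: "U * (1 - fps_const (1 / (a * b)) * fps_X * T') = 1" and
    tail: "somos_tail \<tau> (b + \<tau> / a) (1 / (a * b)) a T'"
    using somos_tail_step[OF Suc.prems(5,4) \<open>a \<noteq> 0\<close>] by blast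
  have b': "1 / (a * b) = H (Suc j + 1) ^ 2 / (H (Suc j) * H (Suc j + 2))"
    unfolding Suc.prems(2,3) using nzj
    by (simp add: field_simps power2_eq_square eval_nat_numeral)
  have "b + \<tau> / a = H (j + 1) * (H (j + 3) * H (j + 1) + \<tau> * H (j + 2) ^ 2) /
                     (H j * H (j + 2) * H (j + 3))"
    unfolding Suc.prems(2,3) using nzj by (simp add: field_simps power2_eq_square)
  also have "\<dots> = H (Suc j + 3) * H (Suc j) / (H (Suc j + 1) * H (Suc j + 2))"
    unfolding rec[OF Suc.prems(1), symmetric] using nzj by (simp add: field_simps eval_nat_numeral)
  finally have a': "b + \<tau> / a = H (Suc j + 3) * H (Suc j) / (H (Suc j + 1) * H (Suc j + 2))" .
  have inv': "1 / (a * b) * ((b + \<tau> / a) * a - \<tau>) = 1"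
    using \<open>a \<noteq> 0\<close> Suc.prems(4) by (auto simp: field_simps)
  have IH: "hankel_det T' n = H (Suc j + n) * H (Suc j) ^ n / (H (Suc j) * H (Suc j + 1) ^ n)"
    "hankel_det (fps_shift 1 T') n =
       H (Suc j + n + 2) * H (Suc j) ^ n / (H (Suc j + 2) * H (Suc j + 1) ^ n)"
    using Suc.IH[OF _ a' b' inv' tail] by auto
  have b'_nz: "a * (1 / (a * b)) = H j * H (j + 2) / H (j + 1) ^ 2"
    unfolding Suc.prems(2,3) using nzj by (simp add: field_simps)
  have "hankel_det T (Suc n) = a ^ n * ((1 / (a * b)) ^ n * hankel_det T' n)"
    using hankel_det_stieltjes(2)[of T a U 1 n] hankel_det_stieltjes(1)[of U _ T' 1 n] TU UT
    by simp
  also have "\<dots> = (H j * H (j + 2) / H (j + 1) ^ 2) ^ n * hankel_det T' n"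
    by (simp only: b'_nz[symmetric] power_mult_distrib mult.assoc)
  finally have 1: "hankel_det T (Suc n) = (H j * H (j + 2) / H (j + 1) ^ 2) ^ n * hankel_det T' n" .
  have "hankel_det (fps_shift 1 T) (Suc n) =
        a ^ Suc n * ((1 / (a * b)) ^ n * hankel_det (fps_shift 1 T') n)"
    using hankel_det_stieltjes(1)[of T a U 1 "Suc n"] hankel_det_stieltjes(2)[of U _ T' 1 n] TU UT
    by simp
  also have "\<dots> = a * (H j * H (j + 2) / H (j + 1) ^ 2) ^ n * hankel_det (fps_shift 1 T') n"
    by (simp only: b'_nz[symmetric] power_mult_distrib mult.assoc power_Suc)
  finally have 2: "hankel_det (fps_shift 1 T) (Suc n) =
      a * (H j * H (j + 2) / H (j + 1) ^ 2) ^ n * hankel_det (fps_shift 1 T') n" .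
  show ?case
    unfolding 1 2 IH unfolding Suc.prems(2)
    using nzj by (simp add: field_simps power2_eq_square eval_nat_numeral)
qed

section \<open>The branch as a Moebius image of a tail\<close>

text \<open>
  The first two levels of the fraction, \<open>G = l / (1 - (r/l) z U)\<close> and \<open>U = 1 / (1 - (m/(l r)) z T)\<close>,
  combine to \<open>G = l S / D\<close> with the \<open>S\<close> and \<open>D\<close> below. Substituting this into
  \<open>A G\<^sup>2 + B G + C\<close> and clearing denominators must give a multiple of the equation of \<open>T\<close>; the multiplier
  is a nonzero constant times \<open>z\<^sup>3\<close> and can be cancelled. With the division by parameters also cleared, it is
  a polynomial identity in seven variables. The coefficient \<open>m/(l r)\<close> is the one that the pattern
  of the later levels would give, \<open>m\<^sup>2/(l r)\<close>, divided by \<open>m\<close>: the empty shifted determinant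
  is \<open>1\<close> while \<open>H 2 = m\<close>.
\<close>

lemma branch_cleared_identity:
  fixes l m r \<eta> \<tau> z T :: "'a::comm_ring_1"
  defines "S \<equiv> l * r - m * z * T"
  defines "D \<equiv> S - r ^ 2 * z"
  shows
   "(l^2 * \<eta> * m * (m - 1) * r
      + (l * (m^2 * r^2 * \<tau> - (m - 1) * l^2 * \<eta>^2
            - m * (m^2 + 2 * m * r^2 - m - r^2) * \<eta> + l * r^3)) * z
      + (r * (- (l^2 * \<eta> * m + m^2 * (m + r^2)) * \<tau> + (2 * m - 1) * l^2 * \<eta>^2
            + \<eta> * m^2 * (m + r^2) - l * r * (m + r^2))) * z ^ 2
      + (l * \<eta> * m * r^2 * (\<tau> - \<eta>)) * z ^ 3) * (l * S) ^ 2
    + (- 2 * l^3 * \<eta> * m * (m - 1) * r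
      + (l^2 * (- 2 * m^2 * r^2 * \<tau> + 2 * (m - 1) * l^2 * \<eta>^2
              + m * (2 * m^2 + 2 * m * r^2 - 2 * m - r^2) * \<eta> - 2 * l * r^3)) * z
      + (r * ((2 * l^3 * \<eta> * m + l * m^2 * (2 * m + r^2)) * \<tau> - (2 * m - 1) * l^3 * \<eta>^2
            - l * \<eta> * m^3 + l^2 * r * (2 * m + r^2))) * z ^ 2
      + (- (l^2 * \<eta> * m * r^2 * \<tau>)) * z ^ 3) * (l * S) * D
    + (l^4 * \<eta> * m * (m - 1) * r
      + (l^3 * m^2 * r^2 * \<tau> + l^4 * r^3 - l^3 * \<eta> * (m - 1) * (l^2 * \<eta> + m^2)) * z
      + (- (l^2 * m * r * (\<tau> * (l^2 * \<eta> + m^2) + l * r))) * z ^ 2) * D ^ 2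
    = l ^ 2 * m * r ^ 2 * z ^ 3 *
      ((m ^ 3 * r * \<eta> * z - l * m ^ 2 * \<eta> ^ 2 * z ^ 2) * T ^ 2
       - (l * m * r ^ 2 * \<eta> - (l ^ 2 * \<eta> ^ 2 * r + r ^ 3 * (l * r + \<tau> * m ^ 2) - m ^ 3 * r * \<eta>) * z
          + l * m * r ^ 2 * \<eta> * \<tau> * z ^ 2) * T
       + (l * m * r ^ 2 * \<eta> - r ^ 3 * (l * r + \<tau> * m ^ 2) * z))"
  unfolding S_def D_def by (simp add: algebra_simps eval_nat_numeral)

lemma fps_const_power_expand: "fps_const (c ^ n) = fps_const (c :: 'a::comm_ring_1) ^ n"
  by (simp add: fps_const_power)

lemmas fps_const_expand =
  fps_const_add[symmetric] fps_const_sub[symmetric] fps_const_neg[symmetric]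
  fps_const_mult[symmetric] fps_const_power_expand

lemma is_branch_iff_somos_tail:
  fixes l m r \<eta> \<tau> :: "'a::field_char_0"
  assumes nz: "l \<noteq> 0" "m \<noteq> 0" "r \<noteq> 0" "\<eta> \<noteq> 0"
    and UT: "U * (1 - fps_const (m / (l * r)) * fps_X * T) = 1"
    and GU: "G * (1 - fps_const (r / l) * fps_X * U) = fps_const l"
  shows "is_branch l m r \<eta> \<tau> G \<longleftrightarrow>
    somos_tail \<tau> (\<eta> * l / (m * r)) (m ^ 2 / (l * r)) (r * (l * r + \<tau> * m ^ 2) / (l * m * \<eta>)) T"
proof -
  define a b e where "a = \<eta> * l / (m * r)" and "b = m ^ 2 / (l * r)"
    and "e = r * (l * r + \<tau> * m ^ 2) / (l * m * \<eta>)"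
  define \<kappa> where "\<kappa> = l * m * r ^ 2 * \<eta>"
  define z :: "'a fps" where "z = fps_X"
  define L M R E \<Theta> where "L = fps_const l" and "M = fps_const m" and "R = fps_const r"
    and "E = fps_const \<eta>" and "\<Theta> = fps_const \<tau>"
  define \<alpha> \<beta> \<epsilon> K where "\<alpha> = fps_const a" and "\<beta> = fps_const b" and "\<epsilon> = fps_const e"
    and "K = fps_const \<kappa>"
  define S where "S = L * R - M * z * T"
  define D where "D = S - R ^ 2 * z"
  define A where "A = fps_of_poly (polyA l m r \<eta> \<tau>)"
  define B where "B = fps_of_poly (polyB l m r \<eta> \<tau>)"
  define C where "C = fps_of_poly (polyC l m r \<eta> \<tau>)"
  define Q where "Q = \<beta> * z * (1 - \<alpha> * z) * T ^ 2
     - (1 - (\<alpha> + \<epsilon> - \<beta>) * z + \<Theta> * z ^ 2) * T + (1 - \<epsilon> * z)"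

  have "L \<noteq> 0" "M \<noteq> 0" "R \<noteq> 0" "K \<noteq> 0" "z \<noteq> 0"
    using nz by (auto simp: L_def M_def R_def K_def \<kappa>_def z_def)
  have Dnz: "D \<noteq> 0"
  proof
    assume "D = 0"
    then have "D $ 0 = 0" by simp
    then show False using nz by (simp add: D_def S_def L_def R_def M_def z_def mult.assoc)
  qed
  have LRm: "L * R * fps_const (m / (l * r)) = M" and Lr: "L * fps_const (r / l) = R"
    using nz by (simp_all add: L_def R_def M_def)
  have "U * S = L * R * (U * (1 - fps_const (m / (l * r)) * fps_X * T))"
    unfolding S_def LRm[symmetric] z_def by (simp add: algebra_simps)
  then have US: "U * S = L * R" using UT by simp
  have "L * (G * D) = L * G * S - R * z * G * (L * R)"
    unfolding D_def by (simp add: algebra_simps power2_eq_square)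
  also have "\<dots> = L * (G * (1 - fps_const (r / l) * fps_X * U)) * S"
    unfolding US[symmetric] unfolding Lr[symmetric] z_def by (simp add: algebra_simps)
  also have "\<dots> = L * (L * S)" using GU by (simp add: L_def)
  finally have GD: "G * D = L * S" using \<open>L \<noteq> 0\<close> by simp

  have poly: "A = L^2 * E * M * (M - 1) * R
      + (L * (M^2 * R^2 * \<Theta> - (M - 1) * L^2 * E^2
            - M * (M^2 + 2 * M * R^2 - M - R^2) * E + L * R^3)) * z
      + (R * (- (L^2 * E * M + M^2 * (M + R^2)) * \<Theta> + (2 * M - 1) * L^2 * E^2
            + E * M^2 * (M + R^2) - L * R * (M + R^2))) * z ^ 2
      + (L * E * M * R^2 * (\<Theta> - E)) * z ^ 3"
    "B = - 2 * L^3 * E * M * (M - 1) * R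
      + (L^2 * (- 2 * M^2 * R^2 * \<Theta> + 2 * (M - 1) * L^2 * E^2
              + M * (2 * M^2 + 2 * M * R^2 - 2 * M - R^2) * E - 2 * L * R^3)) * z
      + (R * ((2 * L^3 * E * M + L * M^2 * (2 * M + R^2)) * \<Theta> - (2 * M - 1) * L^3 * E^2
            - L * E * M^3 + L^2 * R * (2 * M + R^2))) * z ^ 2
      + (- (L^2 * E * M * R^2 * \<Theta>)) * z ^ 3"
    "C = L^4 * E * M * (M - 1) * R
      + (L^3 * M^2 * R^2 * \<Theta> + L^4 * R^3 - L^3 * E * (M - 1) * (L^2 * E + M^2)) * z
      + (- (L^2 * M * R * (\<Theta> * (L^2 * E + M^2) + L * R))) * z ^ 2"
    unfolding A_def B_def C_def polyA_def polyB_def polyC_def fps_of_poly_pCons fps_of_poly_0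
      fps_const_expand fps_const_1_eq_1 fps_numeral_fps_const[symmetric]
      L_def M_def R_def E_def \<Theta>_def z_def
    by (simp_all add: power2_eq_square power3_eq_cube distrib_right mult.assoc)

  \<comment> \<open>The parameters of the tail for \<open>j = 1\<close>, multiplied by their common denominator \<open>\<kappa>\<close>.\<close>
  have clear: "K * \<beta> = M ^ 3 * R * E" "K * (\<beta> * \<alpha>) = L * M ^ 2 * E ^ 2" "K * \<alpha> = L ^ 2 * E ^ 2 * R"
    "K * \<epsilon> = R ^ 3 * (L * R + \<Theta> * M ^ 2)" "K = L * M * R ^ 2 * E"
    unfolding K_def \<alpha>_def \<beta>_def \<epsilon>_def L_def M_def R_def E_def \<Theta>_def \<kappa>_def a_def b_def e_def
    using nz by (simp_all add: fps_const_power field_simps power2_eq_square power3_eq_cube)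

  have "D ^ 2 * (A * G ^ 2 + B * G + C) = A * (G * D) ^ 2 + B * (G * D) * D + C * D ^ 2"
    by (simp only: distrib_left power_mult_distrib power2_eq_square mult_ac)
  also have "\<dots> = A * (L * S) ^ 2 + B * (L * S) * D + C * D ^ 2"
    by (simp only: GD)
  also have "\<dots> = L ^ 2 * M * R ^ 2 * z ^ 3 *
      ((M ^ 3 * R * E * z - L * M ^ 2 * E ^ 2 * z ^ 2) * T ^ 2
       - (L * M * R ^ 2 * E
          - (L ^ 2 * E ^ 2 * R + R ^ 3 * (L * R + \<Theta> * M ^ 2) - M ^ 3 * R * E) * z
          + L * M * R ^ 2 * E * \<Theta> * z ^ 2) * T
       + (L * M * R ^ 2 * E - R ^ 3 * (L * R + \<Theta> * M ^ 2) * z))"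
    unfolding poly S_def D_def by (rule branch_cleared_identity)
  also have "\<dots> = L ^ 2 * M * R ^ 2 * z ^ 3 * (K * Q)"
    unfolding clear[symmetric] Q_def by (simp add: algebra_simps power2_eq_square)
  finally have key: "D ^ 2 * (A * G ^ 2 + B * G + C) = L ^ 2 * M * R ^ 2 * z ^ 3 * (K * Q)" .
  then have "A * G ^ 2 + B * G + C = 0 \<longleftrightarrow> Q = 0"
    using Dnz \<open>L \<noteq> 0\<close> \<open>M \<noteq> 0\<close> \<open>R \<noteq> 0\<close> \<open>K \<noteq> 0\<close> \<open>z \<noteq> 0\<close>
    by (metis mult_eq_0_iff power_not_zero)
  moreover have "U $ 0 = 1" "G $ 0 = l"
    using arg_cong[OF UT, of "\<lambda>F. F $ 0"] arg_cong[OF GU, of "\<lambda>F. F $ 0"]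
    by (simp_all add: mult.assoc)
  moreover have "G $ 1 = r"
    using arg_cong[OF GU, of "\<lambda>F. F $ 1"] nz \<open>U $ 0 = 1\<close> \<open>G $ 0 = l\<close>
    by (simp add: fps_mult_nth mult.assoc)
  moreover have "somos_tail \<tau> a b e T \<longleftrightarrow> Q = 0"
    by (simp add: somos_tail_def Q_def \<alpha>_def \<beta>_def \<epsilon>_def \<Theta>_def z_def)
  ultimately show ?thesis
    unfolding is_branch_def A_def B_def C_def a_def b_def e_def by simp
qed

text \<open>
  The condition \<open>G $ 1 = r\<close> selects the branch: it makes the constant term of \<open>U\<close> equal to \<open>1\<close>, so that
  a second level can be split off.
\<close>

lemma is_branch_decompose:
  fixes l m r \<eta> \<tau> :: "'a::field_char_0"
  assumes "l \<noteq> 0" "m \<noteq> 0" "r \<noteq> 0" "is_branch l m r \<eta> \<tau> G"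
  obtains U T where "U * (1 - fps_const (m / (l * r)) * fps_X * T) = 1"
    and "G * (1 - fps_const (r / l) * fps_X * U) = fps_const l"
proof -
  have G: "G $ 0 = l" "G $ 1 = r" using assms by (auto simp: is_branch_def)
  obtain U where U: "G * (1 - fps_const (r / l) * fps_X * U) = fps_const l"
      "G $ 1 = l * (r / l) * U $ 0"
    by (rule fps_peel_stieltjes[of l "r / l" G]) (use assms G in auto)
  have "U $ 0 = 1" using U(2) G assms by simp
  then obtain T where "U * (1 - fps_const (m / (l * r)) * fps_X * T) = fps_const 1"
    using assms by (rule_tac fps_peel_stieltjes[of 1 "m / (l * r)" U]) auto
  with U(1) that show thesis by simp
qed

lemma is_branch_ex1:
  fixes l m r \<eta> \<tau> :: "'a::field_char_0"
  assumes nz: "l \<noteq> 0" "m \<noteq> 0" "r \<noteq> 0" "\<eta> \<noteq> 0"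
  shows "\<exists>!G. is_branch l m r \<eta> \<tau> G"
proof (rule ex_ex1I)
  define p q where "p = m / (l * r)" and "q = r / l"
  obtain T :: "'a fps" where
    T: "somos_tail \<tau> (\<eta> * l / (m * r)) (m ^ 2 / (l * r)) (r * (l * r + \<tau> * m ^ 2) / (l * m * \<eta>)) T"
    using somos_tail_ex1 by blast
  define U where "U = inverse (1 - fps_const p * fps_X * T)"
  define G where "G = fps_const l * inverse (1 - fps_const q * fps_X * U)"
  have U: "U * (1 - fps_const p * fps_X * T) = 1"
    unfolding U_def by (rule inverse_mult_eq_1) (simp add: mult.assoc)
  have "inverse (1 - fps_const q * fps_X * U) * (1 - fps_const q * fps_X * U) = 1"
    by (rule inverse_mult_eq_1) (simp add: mult.assoc)
  then have "G * (1 - fps_const q * fps_X * U) = fps_const l"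
    unfolding G_def by (simp only: mult.assoc mult_1_right)
  then show "\<exists>G. is_branch l m r \<eta> \<tau> G"
    using is_branch_iff_somos_tail[OF nz] U T unfolding p_def q_def by blast
next
  fix G G' assume G: "is_branch l m r \<eta> \<tau> G" and G': "is_branch l m r \<eta> \<tau> G'"
  define p q where "p = fps_const (m / (l * r)) * fps_X" and "q = fps_const (r / l) * fps_X"
  obtain U T where UT: "U * (1 - p * T) = 1" "G * (1 - q * U) = fps_const l"
    unfolding p_def q_def by (rule is_branch_decompose[OF nz(1-3) G])
  obtain U' T' where UT': "U' * (1 - p * T') = 1" "G' * (1 - q * U') = fps_const l"
    unfolding p_def q_def by (rule is_branch_decompose[OF nz(1-3) G'])
  have "T = T'"
    using is_branch_iff_somos_tail[OF nz UT[unfolded p_def q_def]] G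
      is_branch_iff_somos_tail[OF nz UT'[unfolded p_def q_def]] G' somos_tail_ex1 by blast
  then have "U * (1 - p * T) = U' * (1 - p * T)" using UT(1) UT'(1) by simp
  moreover have "1 - p * T \<noteq> 0" using UT(1) by auto
  ultimately have "U = U'" by simp
  then have "G * (1 - q * U) = G' * (1 - q * U)" using UT(2) UT'(2) by simp
  moreover have "1 - q * U \<noteq> 0" using UT(2) nz by auto
  ultimately show "G = G'" by simp
qed

lemma hankel_det_branch:
  fixes l m r \<eta> \<tau> :: "'a::field_char_0"
  assumes somos: "somos4_seq l m r \<eta> \<tau> H" and nzH: "\<And>n. n \<ge> 1 \<Longrightarrow> H n \<noteq> 0"
    and G: "is_branch l m r \<eta> \<tau> G" and "n \<ge> 1"
  shows "hankel_det G n = H n" "hankel_det (fps_shift 1 G) n = H (n + 2)"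
proof -
  have H: "H 1 = l" "H 2 = m" "H 3 = r" "H 4 = \<eta>"
    and rec: "\<And>n. n \<ge> 1 \<Longrightarrow> H (n + 4) * H n = H (n + 3) * H (n + 1) + \<tau> * H (n + 2) ^ 2"
    using somos by (auto simp: somos4_seq_def)
  have nz: "l \<noteq> 0" "m \<noteq> 0" "r \<noteq> 0" "\<eta> \<noteq> 0"
    using nzH[of 1] nzH[of 2] nzH[of 3] nzH[of 4] H by auto
  obtain U T where UT: "U * (1 - fps_const (m / (l * r)) * fps_X * T) = 1"
    and GU: "G * (1 - fps_const (r / l) * fps_X * U) = fps_const l"
    by (rule is_branch_decompose[OF nz(1-3) G])
  define a b e where "a = \<eta> * l / (m * r)" and "b = m ^ 2 / (l * r)"
    and "e = r * (l * r + \<tau> * m ^ 2) / (l * m * \<eta>)"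
  have tail: "somos_tail \<tau> a b e T"
    using is_branch_iff_somos_tail[OF nz UT GU] G by (simp add: a_def b_def e_def)
  have inv: "b * (a * e - \<tau>) = 1"
    unfolding a_def b_def e_def using nz by (simp add: field_simps power2_eq_square)
  obtain k where k: "n = Suc k" using \<open>n \<ge> 1\<close> by (cases n) auto
  have "hankel_det T k = H (1 + k) * H 1 ^ k / (H 1 * H (1 + 1) ^ k) \<and>
        hankel_det (fps_shift 1 T) k = H (1 + k + 2) * H 1 ^ k / (H (1 + 2) * H (1 + 1) ^ k)"
    by (rule hankel_det_somos_tail[OF rec nzH _ _ _ inv tail])
      (simp_all add: a_def b_def H H(1)[unfolded One_nat_def]
        numeral_3_eq_3[symmetric] flip: numeral_2_eq_2)
  then have T: "hankel_det T k = H n * l ^ k / (l * m ^ k)"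
    "hankel_det (fps_shift 1 T) k = H (n + 2) * l ^ k / (r * m ^ k)"
    using H by (simp_all add: k numeral_2_eq_2 numeral_3_eq_3)
  have "hankel_det G n = l ^ Suc k * (r / l) ^ k * ((m / (l * r)) ^ k * hankel_det T k)"
    unfolding k hankel_det_stieltjes(2)[OF GU] using hankel_det_stieltjes(1)[of U _ T 1 k] UT by simp
  then show "hankel_det G n = H n"
    unfolding T using nz by (simp add: power_divide power_mult_distrib field_simps)
  have "hankel_det (fps_shift 1 G) n = r ^ Suc k * ((m / (l * r)) ^ k * hankel_det (fps_shift 1 T) k)"
    unfolding k hankel_det_stieltjes(1)[OF GU] using hankel_det_stieltjes(2)[of U _ T 1 k] UT nz by simp
  then show "hankel_det (fps_shift 1 G) n = H (n + 2)"
    unfolding T using nz by (simp add: power_divide power_mult_distrib field_simps)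
qed

section \<open>Nondegeneracy of the generic sequence\<close>

fun somos4_iter :: "'a::field \<Rightarrow> 'a \<Rightarrow> 'a \<Rightarrow> 'a \<Rightarrow> 'a \<Rightarrow> nat \<Rightarrow> 'a" where
  "somos4_iter l m r \<eta> \<tau> 0 = 1"
| "somos4_iter l m r \<eta> \<tau> (Suc 0) = l"
| "somos4_iter l m r \<eta> \<tau> (Suc (Suc 0)) = m"
| "somos4_iter l m r \<eta> \<tau> (Suc (Suc (Suc 0))) = r"
| "somos4_iter l m r \<eta> \<tau> (Suc (Suc (Suc (Suc 0)))) = \<eta>"
| "somos4_iter l m r \<eta> \<tau> (Suc (Suc (Suc (Suc (Suc n))))) =
     (somos4_iter l m r \<eta> \<tau> (Suc (Suc (Suc (Suc n)))) * somos4_iter l m r \<eta> \<tau> (Suc (Suc n))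
      + \<tau> * somos4_iter l m r \<eta> \<tau> (Suc (Suc (Suc n))) ^ 2) / somos4_iter l m r \<eta> \<tau> (Suc n)"

lemma somos4_iter_pos:
  fixes l m r \<eta> \<tau> :: "'a::linordered_field"
  assumes "l > 0" "m > 0" "r > 0" "\<eta> > 0" "\<tau> > 0"
  shows "somos4_iter l m r \<eta> \<tau> n > 0"
  using assms
proof (induction l m r \<eta> \<tau> n rule: somos4_iter.induct)
  case (6 l m r \<eta> \<tau> n)
  then show ?case by (auto intro!: divide_pos_pos add_pos_pos mult_pos_pos zero_less_power)
qed auto

lemma somos4_seq_iter:
  assumes "\<And>n. n \<ge> 1 \<Longrightarrow> somos4_iter l m r \<eta> \<tau> n \<noteq> 0"
  shows "somos4_seq l m r \<eta> \<tau> (somos4_iter l m r \<eta> \<tau>)"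
proof -
  have "somos4_iter l m r \<eta> \<tau> (n + 4) * somos4_iter l m r \<eta> \<tau> n =
      somos4_iter l m r \<eta> \<tau> (n + 3) * somos4_iter l m r \<eta> \<tau> (n + 1)
      + \<tau> * somos4_iter l m r \<eta> \<tau> (n + 2) ^ 2" if n: "n \<ge> 1" for n
  proof -
    obtain k where "n = Suc k" using n by (cases n) auto
    then show ?thesis using assms[of n] by (simp add: eval_nat_numeral)
  qed
  then show ?thesis by (simp add: somos4_seq_def eval_nat_numeral)
qed

lemma const_poly_pos: "0 < p \<Longrightarrow> 0 < [:p:]" for p :: "'a::linordered_idom"
  by (simp add: less_poly_def pos_poly_pCons)

lemma X_poly_pos: "0 < [:0, 1 :: 'a::linordered_idom:]"
  by (simp add: less_poly_def pos_poly_pCons)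

lemma to_fract_pos: "0 < p \<Longrightarrow> 0 < to_fract p" for p :: "'a::linordered_idom"
  by (simp add: to_fract_def zero_less_Fract_iff)

text \<open>
  The order on polynomials looks at the sign of the leading coefficient, at every level of the
  iterated polynomial ring.
\<close>

lemma generic_pos: "gen_l > 0" "gen_m > 0" "gen_r > 0" "gen_eta > 0" "gen_tau > 0"
  unfolding gen_l_def gen_m_def gen_r_def gen_eta_def gen_tau_def
  by (intro to_fract_pos const_poly_pos X_poly_pos)+

theorem mainTheorem1:
  fixes l m r \<eta> \<tau> :: "'a::field_char_0" and H :: "nat \<Rightarrow> 'a"
  shows
    "(somos4_seq l m r \<eta> \<tau> H \<and> (\<forall>n\<ge>1. H n \<noteq> 0) \<longrightarrow>
        (\<exists>!G. is_branch l m r \<eta> \<tau> G) \<and>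
        (\<forall>G. is_branch l m r \<eta> \<tau> G \<longrightarrow>
          (\<forall>n\<ge>1. det (mat n n (\<lambda>(i, j). fps_nth G (i + j))) = H n \<and>
                 det (mat n n (\<lambda>(i, j). fps_nth G (i + j + 1))) = H (n + 2)))) \<and>
     (\<exists>K. somos4_seq gen_l gen_m gen_r gen_eta gen_tau K \<and> (\<forall>n\<ge>1. K n \<noteq> 0))"
proof (intro conjI impI)
  assume asm: "somos4_seq l m r \<eta> \<tau> H \<and> (\<forall>n\<ge>1. H n \<noteq> 0)"
  then have somos: "somos4_seq l m r \<eta> \<tau> H" and nzH: "\<And>n. n \<ge> 1 \<Longrightarrow> H n \<noteq> 0" by auto
  have "l \<noteq> 0" "m \<noteq> 0" "r \<noteq> 0" "\<eta> \<noteq> 0"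
    using nzH[of 1] nzH[of 2] nzH[of 3] nzH[of 4] somos by (auto simp: somos4_seq_def)
  then show "\<exists>!G. is_branch l m r \<eta> \<tau> G" by (rule is_branch_ex1)
  show "\<forall>G. is_branch l m r \<eta> \<tau> G \<longrightarrow>
          (\<forall>n\<ge>1. det (mat n n (\<lambda>(i, j). fps_nth G (i + j))) = H n \<and>
                 det (mat n n (\<lambda>(i, j). fps_nth G (i + j + 1))) = H (n + 2))"
    using hankel_det_branch[OF somos nzH] by (simp add: hankel_det_def)
next
  have pos: "somos4_iter gen_l gen_m gen_r gen_eta gen_tau n > 0" for n
    by (rule somos4_iter_pos[OF generic_pos])
  then show "\<exists>K. somos4_seq gen_l gen_m gen_r gen_eta gen_tau K \<and> (\<forall>n\<ge>1. K n \<noteq> 0)"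
    by (intro exI[of _ "somos4_iter gen_l gen_m gen_r gen_eta gen_tau"] conjI somos4_seq_iter)
      (auto simp: less_le)
qed

end
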